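(* Let $\nu$ be a Borel probability measure on $\mathbb{R}$ with finite second moment satisfying $\int x\,d\nu(x)=0$ and $\int x^2\,d\nu(x)=1$. Let $X_1,X_2,\dots$ be an i.i.d. sequence of random variables of law $\nu$. Then $$\frac{1}{2^{n/2}}\sum_{k=1}^{2^n}X_k\xrightarrow{n\to\infty}\mathcal{N}(0,1)$$ in law, where $\mathcal{N}(0,1)$ is the standard normal distribution. *)

theory Defs
  imports "HOL-Probability.Probability"
begin

end

theory Submission
  imports Defs
begin

text \<open>
  The normalised sums in question form the subsequence with indices \<open>2 ^ n\<close> of the
  classical central limit theorem, applied to the shifted sequence \<open>\<lambda>n. X (Suc n)\<close>.
\<close>

lemma (in prob_space) indep_sets_reindex:
  assumes F: "indep_sets F (f ` I)" and f: "inj_on f I"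
  shows "indep_sets (\<lambda>i. F (f i)) I"
proof (rule indep_setsI)
  show "F (f i) \<subseteq> events" if "i \<in> I" for i
    using F that unfolding indep_sets_def by auto
next
  fix A J assume J: "J \<noteq> {}" "J \<subseteq> I" "finite J" and A: "\<forall>j\<in>J. A j \<in> F (f j)"
  have inj: "inj_on f J"
    using f J(2) by (rule inj_on_subset)
  let ?B = "\<lambda>k. A (the_inv_into J f k)"
  have B: "?B (f j) = A j" if "j \<in> J" for j
    using that inj by (simp add: the_inv_into_f_f)
  have "prob (\<Inter>k\<in>f ` J. ?B k) = (\<Prod>k\<in>f ` J. prob (?B k))"
    using J A B by (intro indep_setsD[OF F]) auto
  then show "prob (\<Inter>j\<in>J. A j) = (\<Prod>j\<in>J. prob (A j))"
    by (simp add: prod.reindex[OF inj] B)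
qed

lemma (in prob_space) indep_vars_reindex:
  assumes "indep_vars M' X (f ` I)" and "inj_on f I"
  shows "indep_vars (\<lambda>i. M' (f i)) (\<lambda>i. X (f i)) I"
  using assms unfolding indep_vars_def2 by (auto intro: indep_sets_reindex)

text \<open>Weak convergence is pointwise convergence of distribution functions at continuity points
  of the limit, and each of these real sequences may be thinned out.\<close>

lemma weak_conv_m_subseq:
  assumes "weak_conv_m \<mu> M" and "strict_mono r"
  shows "weak_conv_m (\<lambda>n. \<mu> (r n)) M"
  using assms LIMSEQ_subseq_LIMSEQ[of _ _ r]
  unfolding weak_conv_m_def weak_conv_def comp_def by blast

theorem corollary2p2:
  fixes \<nu> :: "real measure" and M :: "'a measure" and X :: "nat \<Rightarrow> 'a \<Rightarrow> real"
  assumes "real_distribution \<nu>"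
    and "integrable \<nu> (\<lambda>x. x\<^sup>2)"
    and "(LINT x|\<nu>. x) = 0"
    and "(LINT x|\<nu>. x\<^sup>2) = 1"
    and "prob_space M"
    and "prob_space.indep_vars M (\<lambda>_. borel) X {1..}"
    and "\<And>k. k \<ge> 1 \<Longrightarrow> distr M borel (X k) = \<nu>"
  shows "weak_conv_m
    (\<lambda>n. distr M borel (\<lambda>\<omega>. 1 / 2 powr (real n / 2) * (\<Sum>k = 1..2 ^ n. X k \<omega>)))
    std_normal_distribution"
proof -
  interpret prob_space M by fact
  \<comment> \<open>The classical theorem wants a family over all naturals, summed over
    \<open>i < n\<close>; the assumptions on \<open>X\<close> start at index 1.\<close>
  define Y where "Y i = X (Suc i)" for i
  have "range Suc = {1..}"
    by (auto simp: image_iff Suc_le_eq gr0_conv_Suc)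
  then have indep: "indep_vars (\<lambda>_. borel) Y UNIV"
    using indep_vars_reindex[of "\<lambda>_. borel" X Suc UNIV] assms(6)
    by (simp add: Y_def[abs_def])
  then have meas [measurable]: "random_variable borel (Y i)" for i
    unfolding indep_vars_def2 by simp
  have distr: "distr M borel (Y i) = \<nu>" for i
    unfolding Y_def by (rule assms(7)) simp
  have mean: "expectation (Y i) = 0" for i
    using assms(3) unfolding distr[of i, symmetric] by (simp add: integral_distr)
  have square: "integrable M (\<lambda>\<omega>. (Y i \<omega>)\<^sup>2)" for i
    using assms(2) unfolding distr[of i, symmetric] by (simp add: integrable_distr_eq)
  \<comment> \<open>With mean zero the variance is the second moment of \<nu>. The form
    \<open>1\<^sup>2\<close> matches \<sigma> squared in the classical theorem with \<sigma> = 1,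
    whose remaining premise is \<sigma> > 0.\<close>
  have variance: "variance (Y i) = 1\<^sup>2" for i
    using assms(4) unfolding distr[of i, symmetric] by (simp add: integral_distr mean)
  have "weak_conv_m (\<lambda>n. distr M borel (\<lambda>\<omega>. (\<Sum>i<n. Y i \<omega>) / sqrt (real n * 1\<^sup>2)))
    std_normal_distribution"
    by (rule central_limit_theorem_zero_mean[OF indep mean _ square variance distr]) simp
  then have "weak_conv_m
      (\<lambda>n. distr M borel (\<lambda>\<omega>. (\<Sum>i<2 ^ n. Y i \<omega>) / sqrt (real (2 ^ n) * 1\<^sup>2)))
      std_normal_distribution"
    by (rule weak_conv_m_subseq) (simp add: strict_mono_def)
  \<comment> \<open>Undoing the shift and writing the root of \<open>2 ^ n\<close> as a real power
    identifies the two normalised sums pointwise.\<close>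
  moreover have "(\<Sum>i<2 ^ n. Y i \<omega>) / sqrt (real (2 ^ n) * 1\<^sup>2) =
      1 / 2 powr (real n / 2) * (\<Sum>k = 1..2 ^ n. X k \<omega>)" for n \<omega>
  proof -
    have "(\<Sum>i<2 ^ n. Y i \<omega>) = (\<Sum>k = 1..2 ^ n. X k \<omega>)"
      unfolding Y_def by (simp add: sum.atLeast1_atMost_eq)
    moreover have "sqrt (real (2 ^ n)) = 2 powr (real n / 2)"
      by (simp add: powr_half_sqrt_powr powr_realpow)
    ultimately show ?thesis by simp
  qed
  ultimately show ?thesis by simp
qed

end
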